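(* Let $X$ be a $G$-Banach space with $G$-norm $\|\cdot,\cdot,\cdot\|$, let $0<q<1$, and let $T,S\colon X\to X$ be mappings satisfying the following conditions: (1) $T(X)\subseteq S(X)$; (2) $S$ is continuous; (3) $\|Tx-Ty,\,Ty-Tz,\,Tz-Tx\|\le q\,\|Sx-Sy,\,Sy-Sz,\,Sz-Sx\|$ for every $x,y,z\in X$. If $T$ and $S$ commute (i.e. $TSx=STx$ for all $x\in X$), then $T$ and $S$ have a unique common fixed point in $X$.
   Context: A $G$-norm on a real vector space $X$ is a function $\|\cdot,\cdot,\cdot\|\colon X^3\to\mathbb{R}$ such that: [N1] $\|x,y,z\|\ge 0$, and $\|x,y,z\|=0$ if and only if $x=y=z=0$; [N2] $\|x,y,z\|$ is invariant under permutations of $x,y,z$; [N3] $\|\alpha x,\alpha y,\alpha z\|=|\alpha|\,\|x,y,z\|$ for all $\alpha\in\mathbb{R}$, $x,y,z\in X$; [N4] $\|x+x',y+y',z+z'\|\le\|x,y,z\|+\|x',y',z'\|$ for all $x,y,z,x',y',z'\in X$; [N5] $\|x,y,z\|\ge\|x+y,0,z\|$ for all $x,y,z\in X$. The pair $(X,\|\cdot,\cdot,\cdot\|)$ is then called a $G$-normed space. A sequence $(x_n)$ in $X$ converges to $x\in X$ if for every $\epsilon>0$ there is a positive integer $N$ such that $l,m,n\ge N$ implies $\|x_l-x,\,x_m-x,\,x_n-x\|<\epsilon$. A sequence $(x_n)$ in $X$ is a Cauchy sequence if for every $\epsilon>0$ there is a positive integer $N$ such that $l,m,n\ge N$ implies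 $\|x_l-x_m,\,x_m-x_n,\,x_n-x_l\|<\epsilon$. A $G$-normed space is complete if each Cauchy sequence in $X$ converges in $X$. A complete $G$-normed space is called a $G$-Banach space. Continuity of $S$ means: whenever $x_n\to x$ in $X$, then $Sx_n\to Sx$ in $X$. (Equivalently, continuity for the $G$-metric topology of $X$, the topology with base the sets $\{y\in X: G(x,y,y)<r\}$, $x\in X$, $r>0$, where $G(x,y,z)=\|x-y,y-z,z-x\|$; this is the topology of the metric $d_G(x,y)=G(x,y,y)+G(x,x,y)$.) A common fixed point of $T$ and $S$ is a point $u$ with $Tu=Su=u$. *)

theory Defs
  imports Complex_Main
begin

definition G_norm :: "('a::real_vector \<Rightarrow> 'a \<Rightarrow> 'a \<Rightarrow> real) \<Rightarrow> bool" where
  "G_norm N \<longleftrightarrow>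
     (\<forall>x y z. N x y z \<ge> 0 \<and> (N x y z = 0 \<longleftrightarrow> x = 0 \<and> y = 0 \<and> z = 0)) \<and>
     (\<forall>x y z. N x y z = N x z y \<and> N x y z = N y x z \<and> N x y z = N y z x \<and>
              N x y z = N z x y \<and> N x y z = N z y x) \<and>
     (\<forall>a x y z. N (a *\<^sub>R x) (a *\<^sub>R y) (a *\<^sub>R z) = \<bar>a\<bar> * N x y z) \<and>
     (\<forall>x y z x' y' z'. N (x + x') (y + y') (z + z') \<le> N x y z + N x' y' z') \<and>
     (\<forall>x y z. N x y z \<ge> N (x + y) 0 z)"

definition G_converges ::
    "('a::real_vector \<Rightarrow> 'a \<Rightarrow> 'a \<Rightarrow> real) \<Rightarrow> (nat \<Rightarrow> 'a) \<Rightarrow> 'a \<Rightarrow> bool" where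
  "G_converges N X x \<longleftrightarrow>
     (\<forall>\<epsilon>>0. \<exists>M>0. \<forall>l\<ge>M. \<forall>m\<ge>M. \<forall>n\<ge>M. N (X l - x) (X m - x) (X n - x) < \<epsilon>)"

definition G_Cauchy ::
    "('a::real_vector \<Rightarrow> 'a \<Rightarrow> 'a \<Rightarrow> real) \<Rightarrow> (nat \<Rightarrow> 'a) \<Rightarrow> bool" where
  "G_Cauchy N X \<longleftrightarrow>
     (\<forall>\<epsilon>>0. \<exists>M>0. \<forall>l\<ge>M. \<forall>m\<ge>M. \<forall>n\<ge>M. N (X l - X m) (X m - X n) (X n - X l) < \<epsilon>)"

definition G_Banach :: "('a::real_vector \<Rightarrow> 'a \<Rightarrow> 'a \<Rightarrow> real) \<Rightarrow> bool" where
  "G_Banach N \<longleftrightarrow> G_norm N \<and> (\<forall>X. G_Cauchy N X \<longrightarrow> (\<exists>x. G_converges N X x))"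

definition G_continuous ::
    "('a::real_vector \<Rightarrow> 'a \<Rightarrow> 'a \<Rightarrow> real) \<Rightarrow> ('a \<Rightarrow> 'a) \<Rightarrow> bool" where
  "G_continuous N S \<longleftrightarrow>
     (\<forall>X x. G_converges N X x \<longrightarrow> G_converges N (\<lambda>n. S (X n)) (S x))"

end

theory Submission
  imports Defs
begin

text \<open>
  The hypotheses speak of three-variable expressions, but the whole argument takes place in one
  ordinary norm, \<open>p v = N v (- v) 0\<close>. It satisfies \<open>p (x - y) = G(x, y, y)\<close>, so putting two of
  the three points equal in the contraction condition gives \<open>p (T x - T y) \<le> q * p (S x - S y)\<close>.

  The norm \<open>p\<close> need not be equivalent to \<open>v \<mapsto> N v 0 0\<close> on an incomplete space, as the example
  \<open>N x y z = \<parallel>x + y + z\<parallel> + \<bar>x\<bar> + \<bar>y\<bar> + \<bar>z\<bar>\<close> shows when the norm \<open>\<parallel>_\<parallel>\<close> is not bounded by a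
  multiple of the norm \<open>\<bar>_\<bar>\<close>: there \<open>p v = 2 * \<bar>v\<bar>\<close>. But two one-way
  implications suffice: a sequence that is Cauchy for \<open>p\<close> is Cauchy for the \<open>G\<close>-norm
  (\<open>G_Cauchy_of_antipodal\<close>), and a \<open>G\<close>-convergent sequence converges for \<open>p\<close>
  (\<open>antipodal_tendsto_of_G_converges\<close>).

  By \<open>T(X) \<subseteq> S(X)\<close> there are points \<open>x\<^sub>n\<close> with \<open>y\<^sub>n = T x\<^sub>n = S x\<^sub>n\<^sub>+\<^sub>1\<close>. The contraction makes
  \<open>y\<close> Cauchy, so it has a \<open>G\<close>-limit \<open>w\<close>, and \<open>S y\<^sub>n \<rightarrow> S w\<close> by continuity. Since
  \<open>p (T y\<^sub>n - T w) \<le> q * p (S y\<^sub>n - S w)\<close>, also \<open>T y\<^sub>n \<rightarrow> T w\<close>. But commutativity gives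
  \<open>T y\<^sub>n = S y\<^sub>n\<^sub>+\<^sub>1 \<rightarrow> S w\<close>, so \<open>T w = S w\<close>: the maps have a coincidence point. Then \<open>u = T w\<close> is
  the common fixed point, because \<open>S u = T u\<close> and
  \<open>p (T u - u) = p (T u - T w) \<le> q * p (S u - S w) = q * p (T u - u)\<close> forces \<open>T u = u\<close>.
  The same inequality for two common fixed points shows that they coincide.
\<close>

definition antipodal_norm :: "('a::real_vector \<Rightarrow> 'a \<Rightarrow> 'a \<Rightarrow> real) \<Rightarrow> 'a \<Rightarrow> real" where
  "antipodal_norm N v = N v (- v) 0"

lemma
  assumes "G_norm N"
  shows G_norm_nonneg: "0 \<le> N x y z"
    and G_norm_eq_0_iff: "N x y z = 0 \<longleftrightarrow> x = 0 \<and> y = 0 \<and> z = 0"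
    and G_norm_swap12: "N x y z = N y x z"
    and G_norm_swap23: "N x y z = N x z y"
    and G_norm_scale: "N (a *\<^sub>R x) (a *\<^sub>R y) (a *\<^sub>R z) = \<bar>a\<bar> * N x y z"
    and G_norm_triangle: "N (x + x') (y + y') (z + z') \<le> N x y z + N x' y' z'"
    and G_norm_merge: "N (x + y) 0 z \<le> N x y z"
  using assms unfolding G_norm_def by metis+

lemma antipodal_norm_nonneg: "G_norm N \<Longrightarrow> 0 \<le> antipodal_norm N v"
  by (simp add: antipodal_norm_def G_norm_nonneg)

lemma antipodal_norm_eq_0_iff: "G_norm N \<Longrightarrow> antipodal_norm N v = 0 \<longleftrightarrow> v = 0"
  by (simp add: antipodal_norm_def G_norm_eq_0_iff)

lemma antipodal_norm_minus_commute:
  assumes "G_norm N"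
  shows "antipodal_norm N (x - y) = antipodal_norm N (y - x)"
  using G_norm_swap12[OF assms, of "x - y" "y - x" 0] by (simp add: antipodal_norm_def)

lemma antipodal_norm_triangle:
  assumes "G_norm N"
  shows "antipodal_norm N (x - z) \<le> antipodal_norm N (x - y) + antipodal_norm N (y - z)"
  using G_norm_triangle[OF assms, of "x - y" "y - z" "y - x" "z - y" 0 0]
  by (simp add: antipodal_norm_def)

lemma antipodal_norm_eq_G: "G_norm N \<Longrightarrow> antipodal_norm N (x - y) = N (x - y) (y - y) (y - x)"
  by (simp add: antipodal_norm_def G_norm_swap23)

text \<open>The triple of differences of three points splits into two antipodal pairs:
  \<open>(a - b, b - c, c - a) = (a - b, b - a, 0) + (0, a - c, c - a)\<close>.\<close>

lemma G_norm_differences_le: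
  assumes "G_norm N"
  shows "N (a - b) (b - c) (c - a) \<le> antipodal_norm N (a - b) + antipodal_norm N (a - c)"
proof -
  have "N 0 (a - c) (c - a) = antipodal_norm N (a - c)"
    using G_norm_swap12[OF assms, of 0 "a - c" "c - a"] G_norm_swap23[OF assms, of "a - c" 0 "c - a"]
    by (simp add: antipodal_norm_def)
  then show ?thesis
    using G_norm_triangle[OF assms, of "a - b" 0 "b - a" "a - c" 0 "c - a"]
    by (simp add: antipodal_norm_def)
qed

text \<open>Merging the three equal entries gives \<open>3 * N v 0 0 \<le> N v v v\<close>, while splitting the antipodal
  pair gives \<open>N v (- v) 0 \<le> 2 * N v 0 0\<close>.\<close>

lemma antipodal_norm_le_diagonal:
  assumes "G_norm N"
  shows "antipodal_norm N v \<le> N v v v"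
proof -
  have "3 * N v 0 0 = N (v + v + v) 0 0"
  proof -
    have "3 *\<^sub>R v = v + v + v"
      using scaleR_left_distrib[of 2 1 v] by (simp add: scaleR_2)
    then show ?thesis
      using G_norm_scale[OF assms, of 3 v 0 0] by simp
  qed
  also have "\<dots> \<le> N (v + v) v 0"
    by (rule G_norm_merge[OF assms])
  also have "\<dots> = N (v + v) 0 v"
    by (rule G_norm_swap23[OF assms])
  also have "\<dots> \<le> N v v v"
    by (rule G_norm_merge[OF assms])
  finally have merge: "3 * N v 0 0 \<le> N v v v" .
  have "N 0 (- v) 0 = N v 0 0"
    using G_norm_scale[OF assms, of "- 1" v 0 0] G_norm_swap12[OF assms, of 0 "- v" 0] by simp
  then have "antipodal_norm N v \<le> 2 * N v 0 0"
    using G_norm_triangle[OF assms, of v 0 0 "- v" 0 0] by (simp add: antipodal_norm_def)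
  then show ?thesis
    using merge G_norm_nonneg[OF assms, of v 0 0] by linarith
qed

lemma G_Cauchy_of_antipodal:
  assumes N: "G_norm N"
    and bound: "\<And>m n. antipodal_norm N (y m - y n) \<le> r m + r n"
    and r: "r \<longlonglongrightarrow> 0"
  shows "G_Cauchy N y"
  unfolding G_Cauchy_def
proof (intro allI impI)
  fix \<epsilon> :: real assume "\<epsilon> > 0"
  \<comment> \<open>The differences of three points involve four values of \<open>r\<close>.\<close>
  then have "eventually (\<lambda>n. r n < \<epsilon> / 4) sequentially"
    using order_tendstoD(2)[OF r, of "\<epsilon> / 4"] by simp
  then obtain M where M: "\<And>n. n \<ge> M \<Longrightarrow> r n < \<epsilon> / 4"
    by (auto simp: eventually_sequentially)
  have "N (y l - y m) (y m - y n) (y n - y l) < \<epsilon>"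
    if "l \<ge> Suc M" "m \<ge> Suc M" "n \<ge> Suc M" for l m n
    using G_norm_differences_le[OF N, of "y l" "y m" "y n"] bound[of l m] bound[of l n]
      M[of l] M[of m] M[of n] that by linarith
  then show "\<exists>M>0. \<forall>l\<ge>M. \<forall>m\<ge>M. \<forall>n\<ge>M. N (y l - y m) (y m - y n) (y n - y l) < \<epsilon>"
    by blast
qed

lemma antipodal_tendsto_of_G_converges:
  assumes N: "G_norm N" and "G_converges N y w"
  shows "(\<lambda>n. antipodal_norm N (y n - w)) \<longlonglongrightarrow> 0"
proof (rule LIMSEQ_I)
  fix \<epsilon> :: real assume "\<epsilon> > 0"
  then obtain M where "\<And>n. n \<ge> M \<Longrightarrow> N (y n - w) (y n - w) (y n - w) < \<epsilon>"
    using assms(2) unfolding G_converges_def by meson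
  then show "\<exists>M. \<forall>n\<ge>M. norm (antipodal_norm N (y n - w) - 0) < \<epsilon>"
    using antipodal_norm_le_diagonal[OF N] antipodal_norm_nonneg[OF N]
    by (smt (verit) real_norm_def)
qed

lemma antipodal_limit_unique:
  assumes N: "G_norm N"
    and a: "(\<lambda>n. antipodal_norm N (y n - a)) \<longlonglongrightarrow> 0"
    and b: "(\<lambda>n. antipodal_norm N (y n - b)) \<longlonglongrightarrow> 0"
  shows "a = b"
proof -
  have "antipodal_norm N (a - b) \<le> antipodal_norm N (y n - a) + antipodal_norm N (y n - b)" for n
    using antipodal_norm_triangle[OF N, of a b "y n"] antipodal_norm_minus_commute[OF N, of a "y n"]
    by simp
  then have "antipodal_norm N (a - b) \<le> 0"
    using LIMSEQ_le_const[OF tendsto_add[OF a b]] by simp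
  then have "antipodal_norm N (a - b) = 0"
    using antipodal_norm_nonneg[OF N, of "a - b"] by linarith
  then show ?thesis
    using antipodal_norm_eq_0_iff[OF N] by simp
qed

text \<open>The sequence \<open>y\<^sub>n = T x\<^sub>n = S x\<^sub>n\<^sub>+\<^sub>1\<close> satisfies the step condition. Going from \<open>y\<^sub>m\<close> to \<open>y\<^sub>n\<close> through
  \<open>y\<^sub>m\<^sub>+\<^sub>1\<close> and \<open>y\<^sub>n\<^sub>+\<^sub>1\<close> gives \<open>d\<^sub>m\<^sub>n \<le> d\<^sub>m + q * d\<^sub>m\<^sub>n + d\<^sub>n\<close> for the steps \<open>d\<^sub>n \<le> q\<^sup>n * d\<^sub>0\<close>, which
  can be solved for \<open>d\<^sub>m\<^sub>n\<close> and so avoids summing a geometric series.\<close>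

lemma G_Cauchy_of_shift_contraction:
  assumes N: "G_norm N" and q: "0 < q" "q < 1"
    and step: "\<And>m n. antipodal_norm N (y (Suc m) - y (Suc n)) \<le> q * antipodal_norm N (y m - y n)"
  shows "G_Cauchy N y"
proof -
  define d where "d m n = antipodal_norm N (y m - y n)" for m n
  have geometric: "d n (Suc n) \<le> q ^ n * d 0 1" for n
  proof (induction n)
    case (Suc n)
    have "d (Suc n) (Suc (Suc n)) \<le> q * d n (Suc n)"
      using step by (simp add: d_def)
    also have "\<dots> \<le> q * (q ^ n * d 0 1)"
      using Suc q by (intro mult_left_mono) auto
    finally show ?case by (simp add: mult.assoc)
  qed simp
  show ?thesis
  proof (rule G_Cauchy_of_antipodal[OF N, where r = "\<lambda>n. q ^ n * (d 0 1 / (1 - q))"])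
    fix m n
    have "d m n \<le> d m (Suc m) + d (Suc m) (Suc n) + d n (Suc n)"
      using antipodal_norm_triangle[OF N, of "y m" "y n" "y (Suc m)"]
        antipodal_norm_triangle[OF N, of "y (Suc m)" "y n" "y (Suc n)"]
        antipodal_norm_minus_commute[OF N, of "y n" "y (Suc n)"]
      by (simp add: d_def)
    then have "(1 - q) * d m n \<le> q ^ m * d 0 1 + q ^ n * d 0 1"
      using geometric[of m] geometric[of n] step[of m n] by (simp add: d_def algebra_simps)
    then have "d m n \<le> (q ^ m * d 0 1 + q ^ n * d 0 1) / (1 - q)"
      using q by (simp add: pos_le_divide_eq mult.commute)
    then show "antipodal_norm N (y m - y n)
        \<le> q ^ m * (d 0 1 / (1 - q)) + q ^ n * (d 0 1 / (1 - q))"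
      by (simp add: d_def add_divide_distrib)
  next
    show "(\<lambda>n. q ^ n * (d 0 1 / (1 - q))) \<longlonglongrightarrow> 0"
      using q by (intro tendsto_mult_left_zero LIMSEQ_realpow_zero) auto
  qed
qed

lemma eq_of_antipodal_self_contraction:
  assumes N: "G_norm N" and "q < 1"
    and le: "antipodal_norm N (a - b) \<le> q * antipodal_norm N (a - b)"
  shows "a = b"
proof (rule ccontr)
  assume "a \<noteq> b"
  then have "antipodal_norm N (a - b) > 0"
    using antipodal_norm_nonneg[OF N, of "a - b"] antipodal_norm_eq_0_iff[OF N, of "a - b"] by auto
  then have "q * antipodal_norm N (a - b) < 1 * antipodal_norm N (a - b)"
    using \<open>q < 1\<close> by (rule mult_strict_right_mono[rotated])
  with le show False by simp
qed

theorem theorem2p22: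
  fixes N :: "'a::real_vector \<Rightarrow> 'a \<Rightarrow> 'a \<Rightarrow> real"
    and T S :: "'a \<Rightarrow> 'a"
    and q :: real
  assumes "G_Banach N"
    and "0 < q" and "q < 1"
    and "range T \<subseteq> range S"
    and "G_continuous N S"
    and "\<And>x y z. N (T x - T y) (T y - T z) (T z - T x)
                   \<le> q * N (S x - S y) (S y - S z) (S z - S x)"
    and "\<And>x. T (S x) = S (T x)"
  shows "\<exists>!u. T u = u \<and> S u = u"
proof -
  have N: "G_norm N" and complete: "\<And>X. G_Cauchy N X \<Longrightarrow> \<exists>x. G_converges N X x"
    using assms(1) unfolding G_Banach_def by auto
  let ?p = "antipodal_norm N"
  have contraction: "?p (T a - T b) \<le> q * ?p (S a - S b)" for a b
    using assms(6)[of a b b] by (simp only: antipodal_norm_eq_G[OF N])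
  have "\<forall>a. \<exists>b. T a = S b"
    using assms(4) by blast
  then obtain f where f: "\<And>a. T a = S (f a)"
    by (auto dest: choice)
  define x where "x n = (f ^^ n) 0" for n
  define y where "y n = T (x n)" for n
  have y_eq: "y n = S (x (Suc n))" for n
    by (simp add: x_def y_def f)
  have "?p (y (Suc m) - y (Suc n)) \<le> q * ?p (y m - y n)" for m n
    using contraction[of "x (Suc m)" "x (Suc n)"] by (simp add: y_def flip: y_eq)
  then obtain w where w: "G_converges N y w"
    using complete G_Cauchy_of_shift_contraction[OF N assms(2,3)] by blast
  then have Sy: "(\<lambda>n. ?p (S (y n) - S w)) \<longlonglongrightarrow> 0"
    using assms(5) antipodal_tendsto_of_G_converges[OF N] unfolding G_continuous_def by blast
  have "T (y n) = S (y (Suc n))" for n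
    using assms(7)[of "x (Suc n)"] y_eq[of n] by (simp add: y_def)
  then have Ty_Sw: "(\<lambda>n. ?p (T (y n) - S w)) \<longlonglongrightarrow> 0"
    using LIMSEQ_Suc[OF Sy] by simp
  have Ty_Tw: "(\<lambda>n. ?p (T (y n) - T w)) \<longlonglongrightarrow> 0"
  proof (rule tendsto_sandwich[OF _ _ tendsto_const])
    show "(\<lambda>n. q * ?p (S (y n) - S w)) \<longlonglongrightarrow> 0"
      by (rule tendsto_mult_right_zero[OF Sy])
  qed (simp_all add: contraction antipodal_norm_nonneg[OF N])
  have coincidence: "T w = S w"
    by (rule antipodal_limit_unique[OF N Ty_Tw Ty_Sw])
  have "S (T w) = T (T w)"
    using assms(7)[of w] coincidence by simp
  moreover from this have "T (T w) = T w"
    using eq_of_antipodal_self_contraction[OF N assms(3), of "T (T w)" "T w"]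
      contraction[of "T w" w] coincidence by simp
  ultimately have fixed: "T (T w) = T w \<and> S (T w) = T w"
    by simp
  show ?thesis
  proof (rule ex1I[of _ "T w"])
    show "u = T w" if "T u = u \<and> S u = u" for u
      using eq_of_antipodal_self_contraction[OF N assms(3), of u "T w"]
        contraction[of u "T w"] fixed that by simp
  qed (rule fixed)
qed

end
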